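(* Let $\ell\geq1$, $h\geq1$, $1\leq d\leq h$, and let $\mu=(h,1,\dotsc,1)$ be the hook with $\ell+1$ parts. Let $e_k(\mathbf{s})$ denote the $k$th elementary symmetric polynomial in $s_1,\dotsc,s_d$. Then \[ B_{\mu,d}(x,\mathbf{s})=x+\sum_{k=1}^{d}e_k(\mathbf{s})\,x^{\ell+1}(x+x^2+\cdots+x^\ell)^{k-1}, \] and $\sum_{n\geq0}S_{\mu,d,n}(\mathbf{s})x^n=\dfrac{1}{1-B_{\mu,d}(x,\mathbf{s})}$.
   Context: An anchor word for $\mu$ of length $n$ is a word $a_1\cdots a_n$ over $\{1,\dotsc,d,\infty\}$ such that $a_i\neq\infty$ implies $a_{i+k}\geq a_i+\mu_k$ for $k=1,\dotsc,\ell$ ($\infty$ larger than every integer) and $a_{n-\ell+1}=\cdots=a_n=\infty$. The weight of a word is $\mathrm{wt}(w)=\prod_{i:\,a_i\neq\infty}s_{a_i}$. $S_{\mu,d,n}(s_1,\dotsc,s_d)=\sum_w \mathrm{wt}(w)$ over anchor words of length $n$. A fault-free anchor word is either $(\infty)$ or a word starting with an integer, ending with $\ell$ consecutive $\infty$'s, with that final block the only occurrence of $\ell$ consecutive $\infty$'s; $B_{\mu,d}(x,\mathbf{s})=\sum x^{\mathrm{length}(w)}\mathrm{wt}(w)$ over fault-free anchor words $w$. *)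

theory Defs
  imports
    "HOL-Computational_Algebra.Formal_Power_Series"
    "HOL-Library.Extended_Nat"
begin

text \<open>
  A sequence \<open>\<mu> = (\<mu>\<^sub>0, \<dots>, \<mu>\<^sub>\<ell>)\<close> with \<open>\<ell> + 1\<close> parts is a list indexed from \<open>0\<close>, so that \<open>\<mu> ! k\<close>
  is \<open>\<mu>\<^sub>k\<close>; for the hook \<open>(h, 1, \<dots>, 1)\<close> this gives \<open>\<mu>\<^sub>0 = h\<close> and \<open>\<mu>\<^sub>1 = \<dots> = \<mu>\<^sub>\<ell> = 1\<close>.
  Words are lists of extended naturals, and \<open>w ! i\<close> is the letter \<open>a\<^sub>i\<^sub>+\<^sub>1\<close>.
  The weights \<open>s 1, \<dots>, s d\<close> are elements of an arbitrary commutative ring, for instance the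
  indeterminates of a polynomial ring.
\<close>

definition ell :: "nat list \<Rightarrow> nat" where
  "ell \<mu> = length \<mu> - 1"

definition hook :: "nat \<Rightarrow> nat \<Rightarrow> nat list" where
  "hook h l = h # replicate l 1"

definition alphabet :: "nat \<Rightarrow> enat set" where
  "alphabet d = insert \<infinity> (enat ` {1..d})"

text \<open>
  The last condition says that the final \<open>\<ell>\<close> letters are \<open>\<infinity>\<close>. For words shorter than \<open>\<ell>\<close> it says
  that all letters are \<open>\<infinity>\<close>, so there is exactly one anchor word of each length \<open>n < \<ell>\<close>
  (including \<open>n = 0\<close>). Because of it, the guard \<open>i + k < length w\<close> never excludes anything:
  every \<open>i < length w\<close> with \<open>w ! i \<noteq> \<infinity>\<close> satisfies \<open>i + \<ell> < length w\<close>.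
\<close>

definition anchor_word :: "nat list \<Rightarrow> nat \<Rightarrow> enat list \<Rightarrow> bool" where
  "anchor_word \<mu> d w \<longleftrightarrow>
     set w \<subseteq> alphabet d \<and>
     (\<forall>i k. 1 \<le> k \<and> k \<le> ell \<mu> \<and> i + k < length w \<and> w ! i \<noteq> \<infinity>
        \<longrightarrow> w ! (i + k) \<ge> w ! i + enat (\<mu> ! k)) \<and>
     (\<forall>i < length w. length w \<le> i + ell \<mu> \<longrightarrow> w ! i = \<infinity>)"

definition wt :: "(nat \<Rightarrow> 'a::comm_ring_1) \<Rightarrow> enat list \<Rightarrow> 'a" where
  "wt s w = (\<Prod>i | i < length w \<and> w ! i \<noteq> \<infinity>. s (the_enat (w ! i)))"

definition anchor_sum :: "nat list \<Rightarrow> nat \<Rightarrow> nat \<Rightarrow> (nat \<Rightarrow> 'a::comm_ring_1) \<Rightarrow> 'a" where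
  "anchor_sum \<mu> d n s = (\<Sum>w | anchor_word \<mu> d w \<and> length w = n. wt s w)"

text \<open>Starting positions of the blocks of \<open>l\<close> consecutive \<open>\<infinity>\<close>'s in a word.\<close>

definition infinity_blocks :: "nat \<Rightarrow> enat list \<Rightarrow> nat set" where
  "infinity_blocks l w = {j. j + l \<le> length w \<and> (\<forall>k<l. w ! (j + k) = \<infinity>)}"

text \<open>
  The set equation says both that the final \<open>\<ell>\<close> letters form a block of \<open>\<infinity>\<close>'s (and that
  \<open>length w \<ge> \<ell>\<close>) and that there is no other such block.
\<close>

definition fault_free :: "nat list \<Rightarrow> nat \<Rightarrow> enat list \<Rightarrow> bool" where
  "fault_free \<mu> d w \<longleftrightarrow>
     anchor_word \<mu> d w \<and>
     (w = [\<infinity>] \<or>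
      w \<noteq> [] \<and> hd w \<noteq> \<infinity> \<and> infinity_blocks (ell \<mu>) w = {length w - ell \<mu>})"

text \<open>
  The formal sum over all fault-free words is taken coefficientwise; there are only finitely many
  words of each length.
\<close>

definition fault_free_gf :: "nat list \<Rightarrow> nat \<Rightarrow> (nat \<Rightarrow> 'a::comm_ring_1) \<Rightarrow> 'a fps" where
  "fault_free_gf \<mu> d s =
     Abs_fps (\<lambda>n. \<Sum>w | fault_free \<mu> d w \<and> length w = n. wt s w)"

definition elem_sym :: "nat \<Rightarrow> nat \<Rightarrow> (nat \<Rightarrow> 'a::comm_ring_1) \<Rightarrow> 'a" where
  "elem_sym d k s = (\<Sum>I | I \<subseteq> {1..d} \<and> card I = k. \<Prod>i\<in>I. s i)"

end

theory Submission
  imports Defs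
begin

text \<open>
  For a hook, the integers of a fault-free word other than \<open>(\<infinity>)\<close> increase strictly, consecutive
  ones are at distance at most \<open>\<ell>\<close>, and the last one is followed by exactly \<open>\<ell>\<close> letters \<open>\<infinity>\<close>.
  Splitting such words according to whether they begin with the smallest available integer \<open>b\<close>
  shows that adding \<open>b\<close> to a set of larger integers changes the generating function from \<open>G\<close> to
  \<open>G + s\<^sub>b (x\<^sup>\<ell>\<^sup>+\<^sup>1 + (x + \<dots> + x\<^sup>\<ell>) G)\<close>; the sum over the nonempty subsets of the set of integers obeys
  the same recursion. For the second identity, every nonempty anchor word is uniquely a fault-free
  word followed by an anchor word: cut off an initial \<open>\<infinity>\<close>, or else cut after the first block of
  \<open>\<ell>\<close> letters \<open>\<infinity>\<close>.
\<close>

section \<open>Weights\<close>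

text \<open>Letting \<open>\<infinity>\<close> contribute the factor 1 turns the product over
  positions into a product over the list, which is visibly multiplicative under
  concatenation.\<close>

lemma wt_eq_prod_list:
  "wt s w = prod_list (map (\<lambda>a. if a = \<infinity> then 1 else s (the_enat a)) w)"
proof -
  have "wt s w = (\<Prod>i\<in>{i\<in>{..<length w}. w ! i \<noteq> \<infinity>}. s (the_enat (w ! i)))"
    by (simp add: wt_def)
  also have "\<dots> = (\<Prod>i\<in>{..<length w}. if w ! i \<noteq> \<infinity> then s (the_enat (w ! i)) else 1)"
    by (rule prod.inter_filter) simp
  also have "\<dots> = (\<Prod>i = 0..<length w. if w ! i = \<infinity> then 1 else s (the_enat (w ! i)))"
    by (rule prod.cong) auto
  finally show ?thesis
    by (simp add: prod.list_conv_set_nth)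
qed

lemma wt_Nil [simp]: "wt s [] = 1"
  by (simp add: wt_eq_prod_list)

lemma wt_Cons_enat [simp]: "wt s (enat a # w) = s a * wt s w"
  by (simp add: wt_eq_prod_list)

lemma wt_Cons_infinity [simp]: "wt s (\<infinity> # w) = wt s w"
  by (simp add: wt_eq_prod_list)

lemma wt_append [simp]: "wt s (u @ v) = wt s u * wt s v"
  by (simp add: wt_eq_prod_list)

lemma wt_replicate_infinity [simp]: "wt s (replicate g \<infinity>) = 1"
  by (simp add: wt_eq_prod_list)

text \<open>The contribution of a single word to a generating function; a finite set of words then
  has a finite sum of series, and identities can be proved without looking at coefficients.\<close>

definition monom_wt :: "(nat \<Rightarrow> 'a::comm_ring_1) \<Rightarrow> enat list \<Rightarrow> 'a fps" where
  "monom_wt s w = fps_const (wt s w) * fps_X ^ length w"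

lemma Abs_fps_sum_by_length:
  assumes "finite {w. P w}"
  shows "Abs_fps (\<lambda>n. \<Sum>w | P w \<and> length w = n. wt s w) = (\<Sum>w | P w. monom_wt s w)"
proof (rule fps_ext)
  fix n
  have "(\<Sum>w | P w \<and> length w = n. wt s w) = (\<Sum>w\<in>{w\<in>{w. P w}. length w = n}. wt s w)"
    by simp
  also have "\<dots> = (\<Sum>w | P w. if length w = n then wt s w else 0)"
    using assms by (rule sum.inter_filter)
  also have "\<dots> = (\<Sum>w | P w. fps_nth (monom_wt s w) n)"
    by (rule sum.cong) (auto simp: monom_wt_def)
  finally show "fps_nth (Abs_fps (\<lambda>n. \<Sum>w | P w \<and> length w = n. wt s w)) n =
        fps_nth (\<Sum>w | P w. monom_wt s w) n"
    by (simp add: fps_sum_nth)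
qed

section \<open>Anchor words of a hook\<close>

lemma ell_hook [simp]: "ell (hook h l) = l"
  by (simp add: ell_def hook_def)

lemma infinity_in_alphabet [simp]: "\<infinity> \<in> alphabet d"
  by (simp add: alphabet_def)

lemma enat_in_alphabet [simp]: "enat a \<in> alphabet d \<longleftrightarrow> a \<in> {1..d}"
  by (auto simp: alphabet_def)

lemma anchor_word_Nil [simp]: "anchor_word \<mu> d []"
  by (simp add: anchor_word_def)

text \<open>All parts of the hook at indices 1 to \<open>l\<close> equal 1, so the required increase
  is a strict inequality. Writing the distance as \<open>Suc k\<close> matches the positions of a
  tail in the recursion on words.\<close>

lemma anchor_word_hook_iff:
  "anchor_word (hook h l) d w \<longleftrightarrow>
     set w \<subseteq> alphabet d \<and>
     (\<forall>i k. k < l \<and> i + Suc k < length w \<and> w ! i \<noteq> \<infinity> \<longrightarrow> w ! i < w ! (i + Suc k)) \<and>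
     (\<forall>i < length w. length w \<le> i + l \<longrightarrow> w ! i = \<infinity>)"
proof -
  have hook_nth: "hook h l ! Suc k = 1" if "k < l" for k
    using that by (simp add: hook_def)
  \<comment> \<open>Finiteness of \<open>x\<close> matters: for \<open>x = y = \<infinity>\<close>
    the left side holds and the right side fails.\<close>
  have less: "x + enat 1 \<le> y \<longleftrightarrow> x < y" if "x \<noteq> \<infinity>" for x y :: enat
    using that by (cases x; cases y) auto
  have "(\<forall>i k. 1 \<le> k \<and> k \<le> l \<and> i + k < length w \<and> w ! i \<noteq> \<infinity>
          \<longrightarrow> w ! (i + k) \<ge> w ! i + enat (hook h l ! k)) \<longleftrightarrow>
        (\<forall>i k. k < l \<and> i + Suc k < length w \<and> w ! i \<noteq> \<infinity> \<longrightarrow> w ! i < w ! (i + Suc k))"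
    (is "?A \<longleftrightarrow> ?B")
  proof
    assume A: ?A
    show ?B
    proof (intro allI impI)
      fix i k
      assume *: "k < l \<and> i + Suc k < length w \<and> w ! i \<noteq> \<infinity>"
      have "w ! i + enat (hook h l ! Suc k) \<le> w ! (i + Suc k)"
        using A[rule_format, of "Suc k" i] * by simp
      then show "w ! i < w ! (i + Suc k)"
        using * hook_nth less by metis
    qed
  next
    assume B: ?B
    show ?A
    proof (intro allI impI)
      fix i k
      assume *: "1 \<le> k \<and> k \<le> l \<and> i + k < length w \<and> w ! i \<noteq> \<infinity>"
      then obtain k' where k': "k = Suc k'"
        by (cases k) auto
      with * B[rule_format, of k' i] show "w ! (i + k) \<ge> w ! i + enat (hook h l ! k)"
        by (simp add: hook_nth less del: One_nat_def)
    qed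
  qed
  then show ?thesis
    by (simp add: anchor_word_def)
qed

text \<open>Conditions look only forward, and prepending a letter changes no distance to the end, so
  only \<open>a\<close> brings new constraints: it must not be among the last \<open>l\<close>
  letters and must lie below the next \<open>l\<close> ones.\<close>

lemma anchor_word_hook_Cons:
  "anchor_word (hook h l) d (a # w) \<longleftrightarrow>
     a \<in> alphabet d \<and> (a \<noteq> \<infinity> \<longrightarrow> l \<le> length w \<and> (\<forall>x\<in>set (take l w). a < x)) \<and>
     anchor_word (hook h l) d w"
    (is "?L \<longleftrightarrow> ?R")
proof
  assume L: ?L
  then have sub: "set (a # w) \<subseteq> alphabet d"
    and inc: "\<And>i k. k < l \<Longrightarrow> i + Suc k < length (a # w) \<Longrightarrow> (a # w) ! i \<noteq> \<infinity> \<Longrightarrow>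
                (a # w) ! i < (a # w) ! (i + Suc k)"
    and last: "\<And>i. i < length (a # w) \<Longrightarrow> length (a # w) \<le> i + l \<Longrightarrow> (a # w) ! i = \<infinity>"
    unfolding anchor_word_hook_iff by blast+
  have "a < x" if "a \<noteq> \<infinity>" "x \<in> set (take l w)" for x
    using that inc[of _ 0] by (auto simp: in_set_conv_nth)
  moreover have "l \<le> length w" if "a \<noteq> \<infinity>"
    using that last[of 0] by force
  moreover have "anchor_word (hook h l) d w"
    unfolding anchor_word_hook_iff
    using sub inc[of _ "Suc _"] last[of "Suc _"] by auto
  ultimately show ?R
    using sub by auto
next
  assume R: ?R
  then have sub: "set w \<subseteq> alphabet d"
    and inc: "\<And>i k. k < l \<Longrightarrow> i + Suc k < length w \<Longrightarrow> w ! i \<noteq> \<infinity> \<Longrightarrow> w ! i < w ! (i + Suc k)"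
    and last: "\<And>i. i < length w \<Longrightarrow> length w \<le> i + l \<Longrightarrow> w ! i = \<infinity>"
    unfolding anchor_word_hook_iff by blast+
  have "(a # w) ! i < (a # w) ! (i + Suc k)"
    if "k < l" "i + Suc k < length (a # w)" "(a # w) ! i \<noteq> \<infinity>" for i k
  proof (cases i)
    case 0
    then have "w ! k \<in> set (take l w)"
      using that by (auto simp: in_set_conv_nth)
    then show ?thesis
      using 0 R that by simp
  qed (use that inc in auto)
  moreover have "(a # w) ! i = \<infinity>" if "i < length (a # w)" "length (a # w) \<le> i + l" for i
    using that R last by (cases i) auto
  ultimately show ?L
    unfolding anchor_word_hook_iff using R sub by auto
qed

text \<open>An integer of \<open>u\<close> has at least \<open>l\<close> letters after it within
  \<open>u\<close>, so its comparisons never reach \<open>v\<close>.\<close>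

lemma anchor_word_hook_append:
  "anchor_word (hook h l) d u \<Longrightarrow> anchor_word (hook h l) d v \<Longrightarrow> anchor_word (hook h l) d (u @ v)"
  by (induction u) (auto simp: anchor_word_hook_Cons)

lemma anchor_word_hook_replicate: "anchor_word (hook h l) d (replicate n \<infinity>)"
  by (induction n) (auto simp: anchor_word_hook_Cons)

lemma anchor_word_hook_appendD2: "anchor_word (hook h l) d (u @ v) \<Longrightarrow> anchor_word (hook h l) d v"
  by (induction u) (auto simp: anchor_word_hook_Cons)

text \<open>The \<open>l\<close> letters after an integer of \<open>p\<close> already lie inside
  \<open>p @ replicate l \<infinity>\<close>, so dropping \<open>v\<close> changes no
  comparison.\<close>

lemma anchor_word_hook_cut:
  "anchor_word (hook h l) d (p @ replicate l \<infinity> @ v) \<Longrightarrow>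
   anchor_word (hook h l) d (p @ replicate l \<infinity>)"
  by (induction p) (auto simp: anchor_word_hook_Cons anchor_word_hook_replicate)

lemma finite_anchor_words: "finite {w. anchor_word \<mu> d w \<and> length w = n}"
proof (rule finite_subset)
  show "{w. anchor_word \<mu> d w \<and> length w = n} \<subseteq> {w. set w \<subseteq> alphabet d \<and> length w = n}"
    by (auto simp: anchor_word_def)
  show "finite {w. set w \<subseteq> alphabet d \<and> length w = n}"
    by (rule finite_lists_length_eq) (simp add: alphabet_def)
qed

section \<open>Blocks of infinities\<close>

lemma infinity_blocks_append1: "j \<in> infinity_blocks l u \<Longrightarrow> j \<in> infinity_blocks l (u @ v)"
  by (auto simp: infinity_blocks_def nth_append)

text \<open>A block starting at 0 would contain \<open>a\<close>. This uses
  \<open>l \<ge> 1\<close>, since an empty block starts everywhere.\<close>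

lemma infinity_blocks_Cons:
  assumes "l \<ge> 1" "a \<noteq> \<infinity>"
  shows "infinity_blocks l (a # w) = Suc ` infinity_blocks l w"
proof (rule set_eqI)
  fix j
  show "j \<in> infinity_blocks l (a # w) \<longleftrightarrow> j \<in> Suc ` infinity_blocks l w"
  proof (cases j)
    case 0
    have "(a # w) ! (0 + 0) \<noteq> \<infinity>" "0 < l"
      using assms by simp_all
    then have "0 \<notin> infinity_blocks l (a # w)"
      unfolding infinity_blocks_def by (metis (mono_tags, lifting) mem_Collect_eq)
    then show ?thesis
      using 0 by auto
  qed (auto simp: infinity_blocks_def image_iff)
qed

text \<open>A block starting among the first \<open>g < l\<close> letters would have to cover
  position \<open>g\<close>, which holds an integer.\<close>

lemma infinity_blocks_replicate_append:
  assumes "g < l" "w \<noteq> []" "hd w \<noteq> \<infinity>"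
  shows "infinity_blocks l (replicate g \<infinity> @ w) = (+) g ` infinity_blocks l w"
proof (rule set_eqI)
  fix j
  have hd: "(replicate g \<infinity> @ w) ! g \<noteq> \<infinity>"
    using assms by (simp add: nth_append hd_conv_nth)
  show "j \<in> infinity_blocks l (replicate g \<infinity> @ w) \<longleftrightarrow> j \<in> (+) g ` infinity_blocks l w"
  proof (cases "j < g")
    case True
    then have "j + (g - j) = g" "g - j < l"
      using assms by auto
    then have "j \<notin> infinity_blocks l (replicate g \<infinity> @ w)"
      using hd unfolding infinity_blocks_def by (metis (mono_tags, lifting) mem_Collect_eq)
    then show ?thesis
      using True by auto
  next
    case False
    then obtain i where "j = g + i"
      by (metis le_Suc_ex not_less)
    then show ?thesis
      by (auto simp: infinity_blocks_def nth_append add.assoc image_iff)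
  qed
qed

lemma infinity_blocks_replicate: "infinity_blocks l (replicate l \<infinity>) = {0}"
  by (auto simp: infinity_blocks_def)

lemma infinity_blocks_take:
  assumes "j \<in> infinity_blocks l w"
  shows "take (j + l) w = take j w @ replicate l \<infinity>"
proof -
  have "take l (drop j w) = replicate l \<infinity>"
    using assms by (intro nth_equalityI) (auto simp: infinity_blocks_def)
  then show ?thesis
    by (simp add: take_add)
qed

section \<open>The fault-free words\<close>

text \<open>The shape of the fault-free words other than \<open>[\<infinity>]\<close>: increasing
  integers separated by gaps of fewer than \<open>l\<close> infinities, then a final block. An
  arbitrary set \<open>A\<close> of integers is allowed so that one can recurse on its smallest
  element.\<close>

inductive_set gap_chains :: "nat \<Rightarrow> nat set \<Rightarrow> enat list set" for l A where
  last: "a \<in> A \<Longrightarrow> enat a # replicate l \<infinity> \<in> gap_chains l A"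
| step: "a \<in> A \<Longrightarrow> g < l \<Longrightarrow> w \<in> gap_chains l A \<Longrightarrow> \<forall>x\<in>set w. enat a < x \<Longrightarrow>
         enat a # replicate g \<infinity> @ w \<in> gap_chains l A"

lemma gap_chains_hd:
  assumes "w \<in> gap_chains l A"
  shows "w \<noteq> []" "hd w \<noteq> \<infinity>" "x \<in> set w \<Longrightarrow> hd w \<le> x"
  using assms by (cases; auto simp: less_imp_le)+

lemma gap_chains_mono: "w \<in> gap_chains l A \<Longrightarrow> A \<subseteq> B \<Longrightarrow> w \<in> gap_chains l B"
  by (induction rule: gap_chains.induct) (auto intro: gap_chains.intros)

lemma gap_chains_remove: "w \<in> gap_chains l A \<Longrightarrow> enat b \<notin> set w \<Longrightarrow> w \<in> gap_chains l (A - {b})"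
  by (induction rule: gap_chains.induct) (auto intro: gap_chains.intros)

lemma gap_chains_letters: "w \<in> gap_chains l A \<Longrightarrow> set w \<subseteq> insert \<infinity> (enat ` A)"
  by (induction rule: gap_chains.induct) auto

lemma gap_chains_length: "w \<in> gap_chains l A \<Longrightarrow> l < length w"
  by (induction rule: gap_chains.induct) auto

text \<open>The global increase demanded by \<open>step\<close> implies the local one, and a chain
  is longer than \<open>l\<close>, which leaves enough letters after each integer.\<close>

lemma gap_chains_anchor_word: "w \<in> gap_chains l {1..d} \<Longrightarrow> anchor_word (hook h l) d w"
proof (induction rule: gap_chains.induct)
  case (last a)
  then show ?case
    by (auto simp: anchor_word_hook_Cons anchor_word_hook_replicate)
next
  case (step a g w)
  then show ?case
    using gap_chains_length[OF step.hyps(3)]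
    by (auto simp: anchor_word_hook_Cons intro!: anchor_word_hook_append anchor_word_hook_replicate
             dest: in_set_takeD)
qed

text \<open>A gap shorter than \<open>l\<close> creates no block, so each \<open>step\<close> merely
  shifts the single block of the tail.\<close>

lemma gap_chains_infinity_blocks:
  assumes "l \<ge> 1"
  shows "w \<in> gap_chains l A \<Longrightarrow> infinity_blocks l w = {length w - l}"
proof (induction rule: gap_chains.induct)
  case (last a)
  then show ?case
    using assms by (simp add: infinity_blocks_Cons infinity_blocks_replicate)
next
  case (step a g w)
  then show ?case
    using assms gap_chains_length[OF step.hyps(3)] gap_chains_hd(1,2)[OF step.hyps(3)]
    by (simp add: infinity_blocks_Cons infinity_blocks_replicate_append)
qed

text \<open>Peel off the first integer and the gap after it. Anchor words compare only letters at
  distance at most \<open>l\<close>, but short gaps keep neighbouring integers within that range, so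
  the local increase propagates along the word.\<close>

lemma gap_chainsI:
  assumes "l \<ge> 1"
  shows "anchor_word (hook h l) d w \<Longrightarrow> w \<noteq> [] \<Longrightarrow> hd w \<noteq> \<infinity> \<Longrightarrow>
         infinity_blocks l w = {length w - l} \<Longrightarrow> w \<in> gap_chains l {1..d}"
proof (induction "length w" arbitrary: w rule: less_induct)
  case less
  obtain a r where w: "w = enat a # r"
    using less.prems(2,3) by (cases w) auto
  have a: "a \<in> {1..d}" and len: "l \<le> length r" and inc: "\<And>x. x \<in> set (take l r) \<Longrightarrow> enat a < x"
    and r: "anchor_word (hook h l) d r"
    using less.prems(1) by (auto simp: w anchor_word_hook_Cons)
  have blocks: "infinity_blocks l r = {length r - l}"
  proof -
    have "Suc ` infinity_blocks l r = Suc ` {length r - l}"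
      using less.prems(4) assms len by (simp add: w infinity_blocks_Cons Suc_diff_le)
    then show ?thesis
      by (simp only: inj_image_eq_iff[OF inj_Suc])
  qed
  define g where "g = length (takeWhile (\<lambda>x. x = \<infinity>) r)"
  define v where "v = dropWhile (\<lambda>x. x = \<infinity>) r"
  have "takeWhile (\<lambda>x. x = \<infinity>) r = replicate g \<infinity>"
    unfolding g_def
    by (rule replicate_length_same[symmetric]) (auto dest: set_takeWhileD)
  then have r_eq: "r = replicate g \<infinity> @ v"
    using takeWhile_dropWhile_id[of "\<lambda>x. x = \<infinity>" r] by (simp add: v_def)
  have v_hd: "hd v \<noteq> \<infinity>" if "v \<noteq> []"
    using that hd_dropWhile[of "\<lambda>x. x = \<infinity>" r] by (simp add: v_def)
  \<comment> \<open>A gap of length at least \<open>l\<close> is a block at the start of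
    \<open>r\<close>; being the only block, it must be the final one.\<close>
  have g_le: "length r = l" if "l \<le> g"
  proof -
    have "0 \<in> infinity_blocks l r"
      using that by (auto simp: infinity_blocks_def r_eq nth_append)
    then show ?thesis
      using blocks len by simp
  qed
  show ?case
  proof (cases "l \<le> g")
    case True
    then have "v = []" "g = l"
      using g_le r_eq by auto
    then show ?thesis
      using a by (simp add: w r_eq gap_chains.last)
  next
    case False
    then have g: "g < l" and v: "v \<noteq> []"
      using len r_eq by auto
    have shift: "(+) g ` infinity_blocks l v = {length r - l}"
      using blocks infinity_blocks_replicate_append[OF g v v_hd[OF v]] by (simp add: r_eq)
    then have "length r - l \<in> (+) g ` infinity_blocks l v"
      by simp
    then obtain j where j_in: "j \<in> infinity_blocks l v" and j: "g + j = length r - l"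
      by force
    have "i = j" if "i \<in> infinity_blocks l v" for i
      using that shift j by (metis add_left_cancel image_eqI singletonD)
    then have single: "infinity_blocks l v = {j}"
      using j_in by blast
    have "j + l \<le> length v"
      using j_in by (simp add: infinity_blocks_def)
    then have "infinity_blocks l v = {length v - l}"
      using single j by (simp add: r_eq)
    moreover have "anchor_word (hook h l) d v"
      using r anchor_word_hook_appendD2 unfolding r_eq by blast
    ultimately have chain: "v \<in> gap_chains l {1..d}"
      using less.hyps[of v] v v_hd by (simp add: w r_eq)
    \<comment> \<open>The next integer stands at position \<open>g < l\<close> of \<open>r\<close>,
      so it is compared with \<open>a\<close>; by induction it is also the least letter of
      \<open>v\<close>.\<close>
    have "hd v \<in> set (take l r)"
    proof -
      have "hd v = take l r ! g" "g < length (take l r)"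
        using g v by (auto simp: r_eq nth_append hd_conv_nth)
      then show ?thesis
        by (metis nth_mem)
    qed
    then have "\<forall>x\<in>set v. enat a < x"
      using inc gap_chains_hd(3)[OF chain] by (meson less_le_trans)
    then show ?thesis
      unfolding w r_eq using a g chain by (rule_tac gap_chains.step)
  qed
qed

lemma fault_free_hook_iff:
  assumes "l \<ge> 1"
  shows "fault_free (hook h l) d w \<longleftrightarrow> w = [\<infinity>] \<or> w \<in> gap_chains l {1..d}"
proof -
  have "anchor_word (hook h l) d [\<infinity>]"
    using anchor_word_hook_replicate[of h l d 1] by simp
  then show ?thesis
    using assms gap_chainsI[of l h d w] gap_chains_anchor_word[of w l d h] gap_chains_hd(1,2)[of w l "{1..d}"]
      gap_chains_infinity_blocks[of l w "{1..d}"]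
    by (auto simp: fault_free_def)
qed

section \<open>The generating function of the fault-free words\<close>

lemma gap_chains_empty: "gap_chains l {} = {}"
proof -
  have "w \<notin> gap_chains l {}" for w
    by (auto elim: gap_chains.cases)
  then show ?thesis
    by blast
qed

text \<open>Integers in a chain increase, so the smallest one, \<open>b\<close>, can occur only as
  the first letter.\<close>

lemma gap_chains_insert:
  assumes "\<forall>a\<in>A. b < a"
  shows "gap_chains l (insert b A) =
         insert (enat b # replicate l \<infinity>)
           (gap_chains l A \<union> (\<lambda>(g, w). enat b # replicate g \<infinity> @ w) ` ({..<l} \<times> gap_chains l A))"
    (is "_ = ?R")
proof (intro equalityI subsetI)
  fix w
  assume "w \<in> gap_chains l (insert b A)"
  then show "w \<in> ?R"
  proof cases
    case (last a)
    then show ?thesis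
      by (auto intro: gap_chains.intros)
  next
    case (step a g v)
    have "enat b \<notin> set v"
    proof
      assume "enat b \<in> set v"
      then have "a < b"
        using step by force
      then show False
        using step assms by auto
    qed
    then have "v \<in> gap_chains l (insert b A - {b})"
      using step gap_chains_remove by blast
    then have "v \<in> gap_chains l A"
      using gap_chains_mono by blast
    then show ?thesis
      using step by (auto intro: gap_chains.intros)
  qed
next
  fix w
  assume "w \<in> ?R"
  then consider "w = enat b # replicate l \<infinity>" | "w \<in> gap_chains l A"
    | g v where "g < l" "v \<in> gap_chains l A" "w = enat b # replicate g \<infinity> @ v"
    by auto
  then show "w \<in> gap_chains l (insert b A)"
  proof cases
    case 3
    then have "\<forall>x\<in>set v. enat b < x"
      using gap_chains_letters[of v l A] assms by auto
    then show ?thesis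
      using 3 gap_chains_mono[of v l A "insert b A"] by (auto intro: gap_chains.intros)
  qed (auto intro: gap_chains.intros gap_chains_mono)
qed

text \<open>Here \<open>g\<close> is the length of the maximal initial run of \<open>x\<close>. This
  makes the splitting into integer, gap and remaining chain unique.\<close>

lemma replicate_append_cancel:
  assumes "replicate g x @ v = replicate g' x @ v'"
    and "v \<noteq> []" "hd v \<noteq> x" "v' \<noteq> []" "hd v' \<noteq> x"
  shows "g = g' \<and> v = v'"
  using assms
proof (induction g arbitrary: g')
  case 0
  then show ?case
    by (cases g') auto
next
  case (Suc g)
  then show ?case
    by (cases g') auto
qed

lemma finite_gap_chains: "finite A \<Longrightarrow> finite (gap_chains l A)"
  by (induction A rule: finite_linorder_min_induct) (simp_all add: gap_chains_empty gap_chains_insert)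

text \<open>The three kinds of words in \<open>gap_chains_insert\<close> are disjoint. The letter
  \<open>b\<close> with a gap of \<open>g < l\<close> infinities has length \<open>g + 1\<close>,
  whence the factor \<open>x + ... + x^l\<close>.\<close>

lemma sum_monom_wt_gap_chains_insert:
  fixes s :: "nat \<Rightarrow> 'a::comm_ring_1" and l b :: nat
  assumes "finite A" "\<forall>a\<in>A. b < a"
  defines "G \<equiv> \<Sum>w\<in>gap_chains l A. monom_wt s w"
  shows "(\<Sum>w\<in>gap_chains l (insert b A). monom_wt s w) =
         G + fps_const (s b) * (fps_X ^ (l + 1) + (\<Sum>j=1..l. fps_X ^ j) * G)"
proof -
  let ?f = "\<lambda>(g, w). enat b # replicate g \<infinity> @ w"
  let ?w = "enat b # replicate l \<infinity>"
  have fin: "finite (gap_chains l A)"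
    using assms finite_gap_chains by blast
  have cancel: "g = g' \<and> v = v'" if "replicate g \<infinity> @ v = replicate g' \<infinity> @ v'"
    and "v \<in> gap_chains l A" "v' \<in> gap_chains l A" for g g' v v'
    using replicate_append_cancel[OF that(1) gap_chains_hd(1,2)[OF that(2)]
        gap_chains_hd(1,2)[OF that(3)]] .
  have inj: "inj_on ?f ({..<l} \<times> gap_chains l A)"
    by (rule inj_onI) (auto dest: cancel)
  have not_b: "enat b # v \<notin> gap_chains l A" for v
    using gap_chains_letters[of "enat b # v" l A] assms(2) by auto
  \<comment> \<open>Words in the image contain a second integer, the head of the chain
    \<open>v\<close>.\<close>
  have not_w: "?w \<notin> ?f ` ({..<l} \<times> gap_chains l A)"
  proof
    assume "?w \<in> ?f ` ({..<l} \<times> gap_chains l A)"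
    then obtain g v where v: "v \<in> gap_chains l A" and eq: "replicate l \<infinity> = replicate g \<infinity> @ v"
      by auto
    have "set v \<subseteq> {\<infinity>}"
      using arg_cong[OF eq, of set] by (auto split: if_splits)
    then show False
      using gap_chains_hd[OF v] by (cases v) auto
  qed
  have "(\<Sum>w\<in>gap_chains l (insert b A). monom_wt s w) =
        monom_wt s ?w + (G + (\<Sum>w\<in>?f ` ({..<l} \<times> gap_chains l A). monom_wt s w))"
    unfolding gap_chains_insert[OF assms(2)] G_def
    by (subst sum.insert, use fin not_b not_w in auto)[1]
       (subst sum.union_disjoint, use fin not_b in auto)
  also have "(\<Sum>w\<in>?f ` ({..<l} \<times> gap_chains l A). monom_wt s w) =
             (\<Sum>(g, w)\<in>{..<l} \<times> gap_chains l A. fps_const (s b) * fps_X ^ Suc g * monom_wt s w)"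
    unfolding sum.reindex[OF inj]
    by (rule sum.cong) (auto simp: monom_wt_def power_add fps_const_mult[symmetric] mult_ac
          simp del: fps_const_mult)
  also have "\<dots> = (\<Sum>g<l. fps_const (s b) * fps_X ^ Suc g) * G"
    by (simp add: G_def sum_product sum.cartesian_product)
  also have "(\<Sum>g<l. fps_const (s b) * fps_X ^ Suc g) = fps_const (s b) * (\<Sum>j=1..l. fps_X ^ j)"
    by (simp only: One_nat_def sum_distrib_left sum.atLeast1_atMost_eq)
  finally show ?thesis
    by (simp add: monom_wt_def algebra_simps)
qed

text \<open>With \<open>c = x^(l+1)\<close> and \<open>p = x + ... + x^l\<close> this is the
  recursion of the chains. A subset containing \<open>b\<close> is \<open>insert b I\<close>: empty
  \<open>I\<close> yields \<open>c\<close>, and nonempty \<open>I\<close> yields its own term times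
  one more factor \<open>p\<close>.\<close>

lemma sum_nonempty_subsets_insert:
  fixes s :: "'b \<Rightarrow> 'a::comm_ring_1" and c p :: "'a fps"
  assumes "finite A" "b \<notin> A"
  defines "T \<equiv> \<lambda>A. \<Sum>I\<in>Pow A - {{}}. fps_const (prod s I) * c * p ^ (card I - 1)"
  shows "T (insert b A) = T A + fps_const (s b) * (c + p * T A)"
proof -
  let ?t = "\<lambda>I. fps_const (prod s I) * c * p ^ (card I - 1)"
  have inj: "inj_on (insert b) (Pow A)"
    using assms(2) by (intro inj_onI) (metis PowD insert_ident subsetD)
  have "Pow (insert b A) - {{}} = (Pow A - {{}}) \<union> insert b ` Pow A"
    by (auto simp: Pow_insert)
  then have "T (insert b A) = T A + (\<Sum>I\<in>insert b ` Pow A. ?t I)"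
    unfolding T_def using assms(1,2) by (subst sum.union_disjoint[symmetric]) auto
  also have "(\<Sum>I\<in>insert b ` Pow A. ?t I) = (\<Sum>I\<in>Pow A. ?t (insert b I))"
    by (simp add: sum.reindex[OF inj])
  also have "\<dots> = (\<Sum>I\<in>Pow A. fps_const (s b) * (fps_const (prod s I) * c * p ^ card I))"
  proof (rule sum.cong)
    fix I
    assume "I \<in> Pow A"
    then have "finite I" "b \<notin> I"
      using assms finite_subset by auto
    then show "?t (insert b I) = fps_const (s b) * (fps_const (prod s I) * c * p ^ card I)"
      by (simp add: fps_const_mult[symmetric] mult_ac del: fps_const_mult)
  qed simp
  also have "\<dots> = fps_const (s b) * (c + (\<Sum>I\<in>Pow A - {{}}. fps_const (prod s I) * c * p ^ card I))"
    using assms(1) by (simp add: sum_distrib_left[symmetric] sum.remove[of "Pow A" "{}"])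
  also have "(\<Sum>I\<in>Pow A - {{}}. fps_const (prod s I) * c * p ^ card I) = p * T A"
    unfolding T_def sum_distrib_left
  proof (rule sum.cong)
    fix I
    assume "I \<in> Pow A - {{}}"
    \<comment> \<open>Nonemptiness keeps the subtraction in the exponent from being
      truncated.\<close>
    then have "card I = Suc (card I - 1)"
      using assms(1) finite_subset[of I A] card_gt_0_iff[of I] by auto
    then have "p ^ card I = p * p ^ (card I - 1)"
      by (metis power_Suc)
    then show "fps_const (prod s I) * c * p ^ card I = p * ?t I"
      by (simp add: mult_ac)
  qed simp
  finally show ?thesis .
qed

text \<open>Both sides vanish on the empty set and obey the same recursion when an element below all
  others is inserted.\<close>

lemma sum_monom_wt_gap_chains:
  assumes "finite A"
  shows "(\<Sum>w\<in>gap_chains l A. monom_wt s w) =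
         (\<Sum>I\<in>Pow A - {{}}. fps_const (prod s I) * fps_X ^ (l + 1) *
            (\<Sum>j=1..l. fps_X ^ j) ^ (card I - 1))"
  using assms
proof (induction A rule: finite_linorder_min_induct)
  case empty
  then show ?case
    by (simp add: gap_chains_empty)
next
  case (insert b A)
  then have "b \<notin> A"
    by auto
  then show ?case
    using insert sum_nonempty_subsets_insert[OF insert.hyps(1) \<open>b \<notin> A\<close>, of s "fps_X ^ (l + 1)"
        "\<Sum>j=1..l. fps_X ^ j"]
    by (simp only: sum_monom_wt_gap_chains_insert)
qed

text \<open>Group the subsets by cardinality; the factor after the weight depends on nothing
  else.\<close>

lemma sum_nonempty_subsets_elem_sym:
  "(\<Sum>I\<in>Pow {1..d} - {{}}. fps_const (prod s I) * c * p ^ (card I - 1)) =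
   (\<Sum>k=1..d. fps_const (elem_sym d k s) * c * p ^ (k - 1))"
proof -
  let ?N = "Pow {1..d} - {{}}"
  let ?t = "\<lambda>I. fps_const (prod s I) * c * p ^ (card I - 1)"
  have "card I \<in> {1..d}" if "I \<in> ?N" for I
    using that card_mono[of "{1..d}" I] finite_subset[of I "{1..d}"] card_gt_0_iff[of I] by auto
  then have "card ` ?N \<subseteq> {1..d}"
    by blast
  then have "(\<Sum>I\<in>?N. ?t I) = (\<Sum>k=1..d. \<Sum>I\<in>{I\<in>?N. card I = k}. ?t I)"
    by (intro sum.group[symmetric]) simp_all
  also have "\<dots> = (\<Sum>k=1..d. fps_const (elem_sym d k s) * c * p ^ (k - 1))"
  proof (rule sum.cong)
    fix k
    assume "k \<in> {1..d}"
    then have "{I\<in>?N. card I = k} = {I. I \<subseteq> {1..d} \<and> card I = k}"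
      by auto
    then have "fps_const (elem_sym d k s) = (\<Sum>I\<in>{I\<in>?N. card I = k}. fps_const (prod s I))"
      by (simp add: elem_sym_def fps_eq_iff fps_sum_nth)
    then show "(\<Sum>I\<in>{I\<in>?N. card I = k}. ?t I) = fps_const (elem_sym d k s) * c * p ^ (k - 1)"
      by (simp add: sum_distrib_right)
  qed simp
  finally show ?thesis .
qed

lemma fault_free_gf_hook:
  assumes "l \<ge> 1"
  shows "fault_free_gf (hook h l) d s =
         fps_X + (\<Sum>k=1..d. fps_const (elem_sym d k s) * fps_X ^ (l + 1)
                             * (\<Sum>j=1..l. fps_X ^ j) ^ (k - 1))"
proof -
  have eq: "{w. fault_free (hook h l) d w} = insert [\<infinity>] (gap_chains l {1..d})"
    using assms by (auto simp: fault_free_hook_iff)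
  have "[\<infinity>] \<notin> gap_chains l {1..d}"
    using gap_chains_hd(2) by fastforce
  then have "fault_free_gf (hook h l) d s = monom_wt s [\<infinity>] + (\<Sum>w\<in>gap_chains l {1..d}. monom_wt s w)"
    unfolding fault_free_gf_def by (subst Abs_fps_sum_by_length) (simp_all add: eq finite_gap_chains)
  moreover have "monom_wt s [\<infinity>] = fps_X"
    by (simp add: monom_wt_def)
  ultimately show ?thesis
    by (simp only: sum_monom_wt_gap_chains[OF finite_atLeastAtMost] sum_nonempty_subsets_elem_sym)
qed

section \<open>Factorization of anchor words\<close>

lemma anchor_word_decompose:
  assumes "l \<ge> 1" "anchor_word (hook h l) d w" "w \<noteq> []"
  obtains u v where "w = u @ v" "fault_free (hook h l) d u" "anchor_word (hook h l) d v"
proof (cases "hd w = \<infinity>")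
  case True
  with assms(3) have w: "w = [\<infinity>] @ tl w"
    by (cases w) auto
  moreover have "fault_free (hook h l) d [\<infinity>]"
    using assms(1) by (simp add: fault_free_hook_iff)
  moreover have "anchor_word (hook h l) d (tl w)"
    using assms(2) w anchor_word_hook_appendD2 by metis
  ultimately show ?thesis
    using that by blast
next
  case False
  have hd: "w ! 0 \<noteq> \<infinity>"
    using False assms(3) by (simp add: hd_conv_nth)
  then have long: "l < length w"
    using assms(2,3) unfolding anchor_word_hook_iff by force
  \<comment> \<open>The last \<open>l\<close> letters form a block, so a first block exists.\<close>
  then have "length w - l \<in> infinity_blocks l w"
    using assms(2) unfolding anchor_word_hook_iff infinity_blocks_def by auto
  define j where "j = (LEAST j. j \<in> infinity_blocks l w)"
  have j: "j \<in> infinity_blocks l w"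
    unfolding j_def by (rule LeastI) fact
  have least: "j \<le> i" if "i \<in> infinity_blocks l w" for i
    unfolding j_def using that by (rule Least_le)
  define u v where "u = take (j + l) w" and "v = drop (j + l) w"
  have w: "w = u @ v" and len: "length u = j + l"
    using j by (auto simp: u_def v_def infinity_blocks_def)
  obtain p where u: "u = p @ replicate l \<infinity>"
    using infinity_blocks_take[OF j] u_def by blast
  have "anchor_word (hook h l) d u"
    using assms(2) anchor_word_hook_cut[of h l d p v] by (simp add: w u)
  moreover have "u \<noteq> []" "hd u \<noteq> \<infinity>"
    using len assms(1) False by (auto simp: u_def)
  moreover have "infinity_blocks l u = {length u - l}"
  proof -
    have "j \<in> infinity_blocks l u"
      using j len by (auto simp: infinity_blocks_def u_def)
    moreover have "infinity_blocks l u \<subseteq> {j}"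
    proof
      fix i
      assume i: "i \<in> infinity_blocks l u"
      \<comment> \<open>A block of the prefix \<open>u\<close> is a block of \<open>w\<close>, so it
        starts no earlier than \<open>j\<close>; the length \<open>j + l\<close> of \<open>u\<close>
        leaves no room for a later start.\<close>
      have "j \<le> i"
        using least[of i] infinity_blocks_append1[OF i, of v] by (simp add: w)
      moreover have "i + l \<le> length u"
        using i by (simp add: infinity_blocks_def)
      ultimately show "i \<in> {j}"
        using len by simp
    qed
    ultimately have "infinity_blocks l u = {j}"
      by blast
    then show ?thesis
      using len by simp
  qed
  ultimately have "fault_free (hook h l) d u"
    by (simp add: fault_free_def)
  moreover have "anchor_word (hook h l) d v"
    using assms(2) anchor_word_hook_appendD2 unfolding w by blast
  ultimately show ?thesis
    using that w by blast
qed

text \<open>If one chain were a proper prefix of another, its final block would be a second block of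
  the longer one. The word \<open>[\<infinity>]\<close> is told apart from chains by its first
  letter.\<close>

lemma fault_free_prefix_unique:
  assumes "l \<ge> 1" "fault_free (hook h l) d u" "fault_free (hook h l) d u'" "u @ v = u' @ v'"
  shows "u = u'"
proof -
  have chain: "hd (u @ v) \<noteq> \<infinity>" if "u \<in> gap_chains l {1..d}" for u v
    using gap_chains_hd[OF that] by simp
  have le: "length u' \<le> length u"
    if "u \<in> gap_chains l {1..d}" "u' \<in> gap_chains l {1..d}" and eq: "u @ v = u' @ v'" for u v u' v'
  proof (rule ccontr)
    assume "\<not> length u' \<le> length u"
    then obtain t where t: "u' = u @ t"
      using eq by (metis append_eq_append_conv_if append_take_drop_id nat_le_linear)
    have "length u - l \<in> infinity_blocks l u'"
      using gap_chains_infinity_blocks[OF assms(1) that(1)] infinity_blocks_append1 t by blast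
    then show False
      using gap_chains_infinity_blocks[OF assms(1) that(2)] gap_chains_length[OF that(1)]
        \<open>\<not> length u' \<le> length u\<close> by auto
  qed
  have "u' \<notin> gap_chains l {1..d}" if "u = [\<infinity>]"
    using chain[of u' v'] by (auto simp: that assms(4)[symmetric])
  moreover have "u \<notin> gap_chains l {1..d}" if "u' = [\<infinity>]"
    using chain[of u v] by (auto simp: that assms(4))
  ultimately consider "u = [\<infinity>]" "u' = [\<infinity>]" | "u \<in> gap_chains l {1..d}" "u' \<in> gap_chains l {1..d}"
    using assms(1-3) unfolding fault_free_hook_iff[OF assms(1)] by blast
  then show ?thesis
  proof cases
    case 2
    then have "length u = length u'"
      using le[of u u' v v'] le[of u' u v' v] assms(4) by simp
    then show ?thesis
      using assms(4) by simp
  qed simp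
qed

text \<open>Concatenation is a weight-preserving bijection from pairs of a fault-free word and an
  anchor word to the anchor words of length \<open>n\<close>. The condition \<open>n > 0\<close>
  excludes the empty word, which has no fault-free prefix.\<close>

lemma anchor_sum_convolution:
  assumes "l \<ge> 1" "n > 0"
  shows "anchor_sum (hook h l) d n s =
         (\<Sum>i=0..n. (\<Sum>u | fault_free (hook h l) d u \<and> length u = i. wt s u) *
                   anchor_sum (hook h l) d (n - i) s)"
proof -
  define F where "F i = {u. fault_free (hook h l) d u \<and> length u = i}" for i
  define S where "S i = {v. anchor_word (hook h l) d v \<and> length v = i}" for i
  \<comment> \<open>Recording the length \<open>i\<close> of \<open>u\<close> makes the sum over
    \<open>D\<close> split into the terms of a Cauchy product.\<close>
  define D where "D = (SIGMA i:{0..n}. F i \<times> S (n - i))"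
  have fin_S: "finite (S i)" for i
    unfolding S_def by (rule finite_anchor_words)
  have fin_F: "finite (F i)" for i
    by (rule finite_subset[OF _ fin_S[of i]]) (auto simp: F_def S_def fault_free_def)
  have cancel: "i = i' \<and> u = u' \<and> v = v'"
    if eq: "u @ v = u' @ v'" and D: "(i, u, v) \<in> D" "(i', u', v') \<in> D" for i u v i' u' v'
  proof -
    have "u = u'"
      using fault_free_prefix_unique[OF assms(1) _ _ eq] D by (auto simp: D_def F_def)
    then show ?thesis
      using D eq by (auto simp: D_def F_def)
  qed
  have inj: "inj_on (\<lambda>(i, u, v). u @ v) D"
    by (rule inj_onI) (auto dest: cancel)
  have image: "(\<lambda>(i, u, v). u @ v) ` D = S n"
  proof (intro equalityI subsetI)
    fix w
    assume "w \<in> (\<lambda>(i, u, v). u @ v) ` D"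
    then show "w \<in> S n"
      by (auto simp: D_def F_def S_def fault_free_def intro: anchor_word_hook_append)
  next
    fix w
    assume w: "w \<in> S n"
    then obtain u v where "w = u @ v" "fault_free (hook h l) d u" "anchor_word (hook h l) d v"
      using anchor_word_decompose[OF assms(1), of h d w] assms(2) by (auto simp: S_def)
    then have "(length u, u, v) \<in> D"
      using w by (auto simp: D_def F_def S_def)
    then show "w \<in> (\<lambda>(i, u, v). u @ v) ` D"
      using \<open>w = u @ v\<close> by force
  qed
  have "anchor_sum (hook h l) d n s = (\<Sum>w\<in>S n. wt s w)"
    by (simp add: anchor_sum_def S_def)
  also have "\<dots> = (\<Sum>(i, u, v)\<in>D. wt s u * wt s v)"
    unfolding image[symmetric] sum.reindex[OF inj] by (rule sum.cong) auto
  also have "\<dots> = (\<Sum>i=0..n. \<Sum>(u, v)\<in>F i \<times> S (n - i). wt s u * wt s v)"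
    unfolding D_def using fin_F fin_S by (subst sum.Sigma) auto
  also have "\<dots> = (\<Sum>i=0..n. (\<Sum>u\<in>F i. wt s u) * (\<Sum>v\<in>S (n - i). wt s v))"
    by (simp add: sum_product sum.cartesian_product)
  finally show ?thesis
    by (simp add: anchor_sum_def F_def S_def)
qed

section \<open>From the convolution to the identity of power series\<close>

lemma anchor_sum_0 [simp]: "anchor_sum \<mu> d 0 s = 1"
proof -
  have "{w. anchor_word \<mu> d w \<and> length w = 0} = {[]}"
    by auto
  then show ?thesis
    by (simp add: anchor_sum_def)
qed

text \<open>Fault-free words are nonempty. Hence \<open>1 - B\<close> has constant term 1 and is
  invertible over any commutative ring, so an equation \<open>(1 - B) * S = 1\<close> determines
  \<open>S\<close> as the reciprocal.\<close>

lemma fault_free_gf_nth_0: "fps_nth (fault_free_gf \<mu> d s) 0 = 0"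
proof -
  have "{w. fault_free \<mu> d w \<and> length w = 0} = {}"
    by (auto simp: fault_free_def)
  then show ?thesis
    by (simp only: fault_free_gf_def fps_nth_Abs_fps sum.empty)
qed

lemma anchor_sum_gf_hook:
  assumes "l \<ge> 1"
  shows "(1 - fault_free_gf (hook h l) d s) * Abs_fps (\<lambda>n. anchor_sum (hook h l) d n s) = 1"
proof -
  let ?B = "fault_free_gf (hook h l) d s" and ?S = "Abs_fps (\<lambda>n. anchor_sum (hook h l) d n s)"
  \<comment> \<open>The summand 1 accounts for the empty word; positive degrees are the
    convolution.\<close>
  have "?S = 1 + ?B * ?S"
  proof (rule fps_ext)
    fix n
    show "fps_nth ?S n = fps_nth (1 + ?B * ?S) n"
    proof (cases "n = 0")
      case True
      then show ?thesis
        by (simp add: fault_free_gf_nth_0)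
    next
      case False
      then show ?thesis
        using anchor_sum_convolution[OF assms, of n h d s]
        by (simp add: fps_mult_nth fault_free_gf_def)
    qed
  qed
  then show ?thesis
    by (simp add: algebra_simps)
qed

theorem theorem5p3:
  fixes l h d :: nat and s :: "nat \<Rightarrow> 'a::comm_ring_1"
  assumes "l \<ge> 1" and "h \<ge> 1" and "1 \<le> d" and "d \<le> h"
  shows "fault_free_gf (hook h l) d s =
           fps_X + (\<Sum>k=1..d. fps_const (elem_sym d k s) * fps_X ^ (l + 1)
                               * (\<Sum>j=1..l. fps_X ^ j) ^ (k - 1))
         \<and> (1 - fault_free_gf (hook h l) d s) * Abs_fps (\<lambda>n. anchor_sum (hook h l) d n s) = 1"
  using fault_free_gf_hook[OF assms(1)] anchor_sum_gf_hook[OF assms(1)] by blast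

end
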